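(* Let $G_\sigma$ be a finite, simple, connected, unbalanced signed graph whose signed Laplacian $L_\sigma$ has exactly two distinct eigenvalues $\theta_1\neq\theta_2$. Then the exponent of the critical group $\mathcal{K}(G_\sigma)$ equals $\theta_1\theta_2$.
   Context: A signed graph $G_\sigma$ is a graph $G=(V,E)$ with a map $\sigma:E\to\{+,-\}$. It is balanced if every cycle contains an even number of negative edges, and unbalanced otherwise. Its Laplacian is $L_\sigma=D-A_\sigma$, where $D$ is the diagonal matrix of vertex degrees of $G$ and $A_\sigma$ is the signed adjacency matrix with $(A_\sigma)_{uv}=(A_\sigma)_{vu}=1$ for a positive edge $uv$, $-1$ for a negative edge $uv$, and $0$ for non-adjacent $u,v$. When $G_\sigma$ is unbalanced, $L_\sigma$ has full rank, and the critical group is $\mathcal{K}(G_\sigma)=\mathbb{Z}^n/\operatorname{row}_{\mathbb{Z}}L_\sigma$ (the cokernel of $L_\sigma$). The exponent of a finite abelian group is the least positive integer annihilating all its elements. *)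

theory Defs
  imports
    "Graph_Theory.Graph_Theory"
    "Jordan_Normal_Form.Spectral_Radius"
    "HOL-Algebra.Generated_Groups"
begin

text \<open>
  A finite simple graph is a \<^locale>\<open>pair_graph\<close>: every edge \<open>uv\<close> is present as the two arcs
  \<open>(u,v)\<close> and \<open>(v,u)\<close>. A signing is a function on unordered pairs of vertices (two-element sets),
  so both arcs of an edge carry the same sign; its values outside the edge set are never used.
\<close>

datatype sign = Pos | Neg

definition num_neg_arcs :: "('v set \<Rightarrow> sign) \<Rightarrow> ('v \<times> 'v) list \<Rightarrow> nat" where
  "num_neg_arcs \<sigma> p = length (filter (\<lambda>(u, v). \<sigma> {u, v} = Neg) p)"

text \<open>
  The library counts the back-and-forth walk \<open>u, v, u\<close> as a cycle of the symmetric digraph. The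
  bound on the length leaves exactly the cycles of the simple graph; these use each edge
  at most once, so counting arcs counts edges.
\<close>

definition balanced :: "'v pair_pre_digraph \<Rightarrow> ('v set \<Rightarrow> sign) \<Rightarrow> bool" where
  "balanced G \<sigma> \<longleftrightarrow>
     (\<forall>p. pre_digraph.cycle (with_proj G) p \<and> 3 \<le> length p \<longrightarrow> even (num_neg_arcs \<sigma> p))"

text \<open>
  Matrices are indexed by numbers; \<open>vs\<close> is an enumeration of the vertices without repetitions,
  giving the order of the rows and columns.
\<close>

definition degree_matrix :: "'v pair_pre_digraph \<Rightarrow> 'v list \<Rightarrow> int mat" where
  "degree_matrix G vs = mat_diag (length vs) (\<lambda>i. int (out_degree (with_proj G) (vs ! i)))"

definition signed_adjacency_matrix ::
  "'v pair_pre_digraph \<Rightarrow> ('v set \<Rightarrow> sign) \<Rightarrow> 'v list \<Rightarrow> int mat" where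
  "signed_adjacency_matrix G \<sigma> vs = Matrix.mat (length vs) (length vs) (\<lambda>(i, j).
     if (vs ! i, vs ! j) \<in> parcs G
     then (case \<sigma> {vs ! i, vs ! j} of Pos \<Rightarrow> 1 | Neg \<Rightarrow> -1)
     else 0)"

definition signed_laplacian ::
  "'v pair_pre_digraph \<Rightarrow> ('v set \<Rightarrow> sign) \<Rightarrow> 'v list \<Rightarrow> int mat" where
  "signed_laplacian G \<sigma> vs = degree_matrix G vs - signed_adjacency_matrix G \<sigma> vs"

definition int_cokernel :: "int mat \<Rightarrow> int vec set monoid" where
  "int_cokernel A =
     monoid_vec TYPE(int) (dim_col A) Mod
       generate (monoid_vec TYPE(int) (dim_col A)) (set (rows A))"

definition critical_group ::
  "'v pair_pre_digraph \<Rightarrow> ('v set \<Rightarrow> sign) \<Rightarrow> 'v list \<Rightarrow> int vec set monoid" where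
  "critical_group G \<sigma> vs = int_cokernel (signed_laplacian G \<sigma> vs)"

text \<open>The value \<open>0\<close> marks groups that no positive integer annihilates; none of them is finite.\<close>

definition group_exponent :: "('a, 'b) monoid_scheme \<Rightarrow> nat" where
  "group_exponent G =
     (if \<exists>m>0. \<forall>x\<in>carrier G. x [^]\<^bsub>G\<^esub> (m::nat) = \<one>\<^bsub>G\<^esub>
      then LEAST m. 0 < m \<and> (\<forall>x\<in>carrier G. x [^]\<^bsub>G\<^esub> m = \<one>\<^bsub>G\<^esub>)
      else 0)"

lemma comm_group_int_cokernel: "comm_group (int_cokernel A)"
proof -
  let ?Z = "monoid_vec TYPE(int) (dim_col A)"
  interpret Z: comm_group ?Z by (rule comm_group_vec)
  have "set (rows A) \<subseteq> carrier ?Z"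
    by (auto simp: rows_def monoid_vec_simps)
  then have "subgroup (generate ?Z (set (rows A))) ?Z"
    by (rule Z.generate_is_subgroup)
  then show ?thesis
    unfolding int_cokernel_def by (rule Z.abelian_FactGroup)
qed

end

theory Submission
  imports Defs
begin

text \<open>
  The symmetric matrix \<open>L\<close> satisfies \<open>L\<^sup>2 = s L - p I\<close> with \<open>s = \<theta>\<^sub>1 + \<theta>\<^sub>2\<close> and \<open>p = \<theta>\<^sub>1 \<theta>\<^sub>2\<close>.
  The entry of this equation at an edge, where \<open>L\<close> is \<open>\<plusminus>1\<close>, shows that \<open>s\<close> is an integer, and then a
  diagonal entry shows that \<open>p\<close> is; diagonal dominance of \<open>L\<close> gives \<open>p \<ge> 0\<close>. Put \<open>K = s I - L\<close>, so that
  \<open>L K = K L = p I\<close>. Every \<open>p v = L (K v)\<close> lies in the row lattice, so \<open>p\<close> annihilates the cokernel.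
  Conversely, if \<open>m e\<^sub>j = L y\<close> for an edge \<open>ij\<close>, then \<open>m K e\<^sub>j = p y\<close>, whose \<open>i\<close>-th entry is \<open>\<plusminus>m\<close>, so
  \<open>p\<close> divides \<open>m\<close>.
\<close>

section \<open>Symmetric real matrices with two eigenvalues\<close>

text \<open>The embedding of real into complex polynomials is multiplicative and injective, and a
  linear factor with real root \<open>z\<close> is the image of
  \<open>[:- Re z, 1:]\<close>.\<close>

lemma of_real_poly_splits:
  fixes p :: "real poly"
  assumes p: "map_poly complex_of_real p = (\<Prod>z\<leftarrow>zs. [:- z, 1:])" and zs: "set zs \<subseteq> \<real>"
  shows "p = (\<Prod>x\<leftarrow>map Re zs. [:- x, 1:])"
proof -
  interpret h: map_poly_inj_idom_hom complex_of_real ..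
  have lin: "map_poly complex_of_real [:- Re z, 1:] = [:- z, 1:]" if "z \<in> \<real>" for z
    using that by (auto simp: map_poly_pCons elim: Reals_cases)
  have "map_poly complex_of_real (\<Prod>x\<leftarrow>map Re zs. [:- x, 1:]) = (\<Prod>z\<leftarrow>zs. [:- z, 1:])"
    using zs
  proof (induction zs)
    case (Cons z zs)
    then have "map_poly complex_of_real [:- Re z, 1:] = [:- z, 1:]" by (intro lin) simp
    moreover have "map_poly complex_of_real (\<Prod>x\<leftarrow>map Re zs. [:- x, 1:]) = (\<Prod>z\<leftarrow>zs. [:- z, 1:])"
      using Cons by simp
    ultimately show ?case by (simp only: list.map prod_list.Cons h.hom_mult)
  qed simp
  with p show ?thesis using h.injectivity by presburger
qed

text \<open>For an eigenvector \<open>v\<close>, moving the matrix across the Hermitian product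
  gives \<open>z * (v \<bullet>c v) = cnj z * (v \<bullet>c v)\<close>, and
  \<open>v \<bullet>c v\<close> is nonzero.\<close>

lemma symmetric_real_mat_complex_eigenvalue_real:
  fixes A :: "real mat"
  assumes A: "A \<in> carrier_mat n n" and sym: "A\<^sup>T = A"
    and z: "eigenvalue (map_mat complex_of_real A) z"
  shows "z \<in> \<real>"
proof -
  let ?C = "map_mat complex_of_real A"
  have C: "?C \<in> carrier_mat n n" using A by simp
  have symC: "?C\<^sup>T = ?C" by (subst map_mat_transpose) (simp add: sym)
  obtain v where v: "v \<in> carrier_vec n" "v \<noteq> 0\<^sub>v n" "?C *\<^sub>v v = z \<cdot>\<^sub>v v"
    using z A unfolding eigenvalue_def eigenvector_def by auto
  \<comment> \<open>The entries of \<open>?C\<close> are real, hence fixed by conjugation.\<close>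
  have conj: "conjugate (?C *\<^sub>v v) = ?C *\<^sub>v conjugate v"
    using A v(1) by (intro eq_vecI) (auto simp: scalar_prod_def sum_conjugate conjugate_dist_mul)
  have "z * (v \<bullet>c v) = (?C *\<^sub>v v) \<bullet>c v" using v by simp
  also have "\<dots> = v \<bullet> (?C *\<^sub>v conjugate v)"
    using transpose_vec_mult_scalar[OF C, of "conjugate v" v] v(1) symC C
      by (smt (verit) carrier_vec_conjugate comm_scalar_prod mult_mat_vec_carrier)
  also have "\<dots> = v \<bullet>c (z \<cdot>\<^sub>v v)" by (simp flip: conj v(3))
  also have "\<dots> = cnj z * (v \<bullet>c v)" using v(1) by (simp add: conjugate_smult_vec)
  finally have "z = cnj z" using v by auto
  then show ?thesis by (simp add: complex_is_Real_iff complex_eq_iff)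
qed

text \<open>Over the complex numbers the polynomial factors, and its roots are eigenvalues, hence
  real. The splitting is what a Schur decomposition over the reals requires.\<close>

lemma symmetric_real_mat_char_poly_splits:
  fixes A :: "real mat"
  assumes A: "A \<in> carrier_mat n n" and sym: "A\<^sup>T = A"
  shows "\<exists>es. char_poly A = (\<Prod>e\<leftarrow>es. [:- e, 1:])"
proof -
  let ?C = "map_mat complex_of_real A"
  have C: "?C \<in> carrier_mat n n" using A by simp
  obtain zs where zs: "char_poly ?C = (\<Prod>z\<leftarrow>zs. [:- z, 1:])"
    using char_poly_factorized[OF C] by blast
  have "set zs \<subseteq> \<real>"
  proof
    fix z assume "z \<in> set zs"
    then have "poly (char_poly ?C) z = 0" unfolding zs by (simp add: poly_prod_list_zero_iff)
    then show "z \<in> \<real>"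
      using symmetric_real_mat_complex_eigenvalue_real[OF A sym] eigenvalue_root_char_poly[OF C]
      by blast
  qed
  with of_real_poly_splits zs of_real_hom.char_poly_hom[OF A] show ?thesis by metis
qed

section \<open>Traces and their behaviour under similarity\<close>

definition mat_trace :: "'a :: comm_ring_1 mat \<Rightarrow> 'a" where
  "mat_trace A = sum_list (diag_mat A)"

lemma mat_trace_sum: "mat_trace A = (\<Sum>i<dim_row A. A $$ (i, i))"
  unfolding mat_trace_def diag_mat_def by (simp add: sum_list_sum_nth atLeast0LessThan)

lemma mat_trace_mult_comm:
  assumes "A \<in> carrier_mat n m" "B \<in> carrier_mat m n"
  shows "mat_trace (A * B) = mat_trace (B * A)"
proof -
  have "(\<Sum>i<n. \<Sum>k<m. A $$ (i, k) * B $$ (k, i)) = (\<Sum>k<m. \<Sum>i<n. A $$ (i, k) * B $$ (k, i))"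
    by (rule sum.swap)
  with assms show ?thesis
    by (simp add: mat_trace_sum scalar_prod_def atLeast0LessThan mult.commute)
qed

text \<open>This takes the place of diagonalization: information on the trace alone, which
  similarity preserves, forces a symmetric matrix to vanish.\<close>

lemma symmetric_mat_eq_0_if_trace_square_0:
  fixes M :: "real mat"
  assumes M: "M \<in> carrier_mat n n" and sym: "M\<^sup>T = M" and tr: "mat_trace (M * M) = 0"
  shows "M = 0\<^sub>m n n"
proof -
  have s: "M $$ (j, i) = M $$ (i, j)" if "i < n" "j < n" for i j
    using that M sym by (metis carrier_matD index_transpose_mat(1))
  have "0 = (\<Sum>i<n. \<Sum>j<n. M $$ (i, j) * M $$ (j, i))"
    using tr M by (simp add: mat_trace_sum scalar_prod_def atLeast0LessThan)
  also have "\<dots> = (\<Sum>i<n. \<Sum>j<n. (M $$ (i, j))\<^sup>2)"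
    by (intro sum.cong refl) (simp add: s power2_eq_square)
  finally have "\<forall>i<n. (\<Sum>j<n. (M $$ (i, j))\<^sup>2) = 0"
    by (subst (asm) eq_commute, subst (asm) sum_nonneg_eq_0_iff) (auto intro: sum_nonneg)
  then have "\<forall>i<n. \<forall>j<n. M $$ (i, j) = 0" by (auto simp: sum_nonneg_eq_0_iff)
  with M show ?thesis by (intro eq_matI) auto
qed

text \<open>Conjugation fixes scalar matrices. The witnesses \<open>P\<close> and \<open>Q\<close>
  stay the same, so that shifted matrices can be multiplied afterwards.\<close>

lemma similar_mat_wit_minus_smult_one:
  fixes A :: "'a :: comm_ring_1 mat"
  assumes A: "A \<in> carrier_mat n n" and sim: "similar_mat_wit A B P Q"
  shows "similar_mat_wit (A - c \<cdot>\<^sub>m 1\<^sub>m n) (B - c \<cdot>\<^sub>m 1\<^sub>m n) P Q"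
proof -
  note w = similar_mat_witD2[OF A sim]
  have "P * (B - c \<cdot>\<^sub>m 1\<^sub>m n) * Q = (P * B - c \<cdot>\<^sub>m P) * Q"
    using w(4-) by (simp add: mult_minus_distrib_mat[of _ n n _ n] mult_smult_distrib[of _ n n _ n])
  also have "\<dots> = P * B * Q - c \<cdot>\<^sub>m P * Q"
    using w(4-) by (intro minus_mult_distrib_mat[of _ n n _ _ n]) auto
  also have "c \<cdot>\<^sub>m P * Q = c \<cdot>\<^sub>m 1\<^sub>m n"
    using w(1,4-) by (simp add: mult_smult_assoc_mat[of _ n n _ n])
  finally show ?thesis using w by (intro similar_mat_witI[of _ _ n]) auto
qed

text \<open>With common witnesses the inner factor \<open>Q * P\<close> cancels.\<close>

lemma similar_mat_wit_mult:
  fixes A :: "'a :: comm_ring_1 mat"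
  assumes A: "A \<in> carrier_mat n n"
    and sim: "similar_mat_wit A B P Q" "similar_mat_wit A' B' P Q"
  shows "similar_mat_wit (A * A') (B * B') P Q"
proof -
  note w = similar_mat_witD2[OF A sim(1)]
  have A': "A' \<in> carrier_mat n n"
    using sim(2) w(6) unfolding similar_mat_wit_def Let_def by auto
  note w' = similar_mat_witD2[OF A' sim(2)]
  note assoc = assoc_mult_mat[of _ n n _ n _ n]
  have "Q * (P * B' * Q) = Q * P * (B' * Q)"
    using w'(5-) by (simp only: assoc mult_carrier_mat)
  also have "\<dots> = B' * Q" using w(2) w'(5,7) by (simp only: left_mult_one_mat[of _ n n] mult_carrier_mat)
  finally have "P * B * Q * (P * B' * Q) = P * (B * B') * Q"
    using w(5-) w'(5) by (simp only: assoc mult_carrier_mat)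
  with w(3) w'(3) have "A * A' = P * (B * B') * Q" by simp
  then show ?thesis using w w' by (intro similar_mat_witI[of _ _ n]) auto
qed

text \<open>Cyclicity of the trace brings \<open>Q\<close> next to \<open>P\<close>, where they
  cancel.\<close>

lemma similar_mat_wit_trace:
  assumes A: "A \<in> carrier_mat n n" and sim: "similar_mat_wit A B P Q"
  shows "mat_trace A = mat_trace B"
proof -
  note w = similar_mat_witD2[OF A sim]
  have "mat_trace A = mat_trace (Q * (P * B))"
    using w mat_trace_mult_comm[of "P * B" n n Q] by simp
  also have "Q * (P * B) = B" using w by (simp flip: assoc_mult_mat[of Q n n P n _ n])
  finally show ?thesis .
qed

section \<open>The quadratic equation of a symmetric matrix with at most two eigenvalues\<close>

text \<open>The right-hand side is symmetric in \<open>x\<close> and \<open>y\<close>, so the two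
  shifted factors commute.\<close>

lemma mat_minus_smult_one_mult:
  fixes A :: "'a :: comm_ring_1 mat"
  assumes A: "A \<in> carrier_mat n n"
  shows "(A - x \<cdot>\<^sub>m 1\<^sub>m n) * (A - y \<cdot>\<^sub>m 1\<^sub>m n) = A * A - (x + y) \<cdot>\<^sub>m A + (x * y) \<cdot>\<^sub>m 1\<^sub>m n"
proof -
  let ?X = "A - x \<cdot>\<^sub>m 1\<^sub>m n"
  have X: "?X \<in> carrier_mat n n" using A by auto
  have "?X * (A - y \<cdot>\<^sub>m 1\<^sub>m n) = ?X * A - ?X * (y \<cdot>\<^sub>m 1\<^sub>m n)"
    using A X by (intro mult_minus_distrib_mat[of _ n n]) auto
  also have "?X * (y \<cdot>\<^sub>m 1\<^sub>m n) = y \<cdot>\<^sub>m ?X"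
    using X by (simp add: mult_smult_distrib[of _ n n _ n])
  also have "?X * A = A * A - x \<cdot>\<^sub>m 1\<^sub>m n * A"
    using A by (intro minus_mult_distrib_mat[of _ n n]) auto
  also have "x \<cdot>\<^sub>m 1\<^sub>m n * A = x \<cdot>\<^sub>m A"
    using A by (simp add: mult_smult_assoc_mat[of _ n n _ n])
  finally show ?thesis using A by (auto simp: mat_eq_iff algebra_simps)
qed

text \<open>
  After triangularization, \<open>M = (A - a)(A - b)\<close> becomes strictly upper triangular, so \<open>M\<^sup>2\<close> has trace
  \<open>0\<close>. As \<open>M\<close> is symmetric, that trace is the sum of the squares of its entries.
\<close>

lemma symmetric_real_mat_two_eigenvalues:
  fixes A :: "real mat"
  assumes A: "A \<in> carrier_mat n n" and sym: "A\<^sup>T = A" and spec: "spectrum A \<subseteq> {a, b}"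
  shows "A * A = (a + b) \<cdot>\<^sub>m A - (a * b) \<cdot>\<^sub>m 1\<^sub>m n"
proof -
  let ?S = "\<lambda>X c. X - c \<cdot>\<^sub>m 1\<^sub>m n :: real mat"
  let ?M = "?S A a * ?S A b"
  obtain es where es: "char_poly A = (\<Prod>e\<leftarrow>es. [:- e, 1:])"
    using symmetric_real_mat_char_poly_splits[OF A sym] by blast
  \<comment> \<open>The decomposition places the prescribed real roots \<open>es\<close> on the
    diagonal of the triangular matrix \<open>B\<close>.\<close>
  obtain B P Q where "schur_decomposition A es = (B, P, Q)" by (metis prod_cases3)
  from schur_decomposition[OF A es this]
  have sim: "similar_mat_wit A B P Q" and ut: "upper_triangular B" and diag: "diag_mat B = es"
    by auto
  have B: "B \<in> carrier_mat n n" using similar_mat_witD2[OF A sim] by simp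
  have Bii: "B $$ (i, i) \<in> {a, b}" if "i < n" for i
  proof -
    have "B $$ (i, i) \<in> set es" using that B by (auto simp flip: diag simp: diag_mat_def)
    then have "poly (char_poly A) (B $$ (i, i)) = 0"
      unfolding es by (simp add: poly_prod_list_zero_iff)
    with spec show ?thesis by (auto simp: spectrum_root_char_poly[OF A])
  qed
  let ?N = "?S B a * ?S B b"
  \<comment> \<open>Both factors are upper triangular, so on or below the diagonal only a term with
    \<open>i = k = j\<close> could survive. That term is
    \<open>(B $$ (i, i) - a) * (B $$ (i, i) - b)\<close>, which is zero.\<close>
  have N: "?N $$ (i, j) = 0" if "j \<le> i" "i < n" for i j
  proof -
    have "?S B a $$ (i, k) * ?S B b $$ (k, j) = 0" if "k < n" for k
    proof (cases "k = i \<and> k = j")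
      case True
      with Bii[OF \<open>i < n\<close>] B \<open>i < n\<close> show ?thesis by auto
    next
      case False
      then have "k < i \<or> j < k" using \<open>j \<le> i\<close> by auto
      with ut B \<open>k < n\<close> that \<open>i < n\<close> show ?thesis by (auto simp: upper_triangular_def)
    qed
    moreover have "?N $$ (i, j) = (\<Sum>k<n. ?S B a $$ (i, k) * ?S B b $$ (k, j))"
      using that B by (simp add: scalar_prod_def atLeast0LessThan)
    ultimately show ?thesis by (auto intro: sum.neutral)
  qed
  \<comment> \<open>One of the positions \<open>(i, k)\<close> and \<open>(k, i)\<close> is always
    on or below the diagonal.\<close>
  have "(?N * ?N) $$ (i, i) = 0" if "i < n" for i
  proof -
    have "?N $$ (i, k) * ?N $$ (k, i) = 0" if "k < n" for k
      using N[of k i] N[of i k] \<open>i < n\<close> that by (cases "k \<le> i") auto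
    moreover have "(?N * ?N) $$ (i, i) = (\<Sum>k<n. ?N $$ (i, k) * ?N $$ (k, i))"
      using that B by (simp add: scalar_prod_def atLeast0LessThan)
    ultimately show ?thesis by (auto intro: sum.neutral)
  qed
  then have "mat_trace (?N * ?N) = 0" using B by (simp add: mat_trace_sum)
  moreover have "similar_mat_wit ?M ?N P Q"
    using A by (intro similar_mat_wit_mult[of _ n] similar_mat_wit_minus_smult_one sim) auto
  then have "similar_mat_wit (?M * ?M) (?N * ?N) P Q"
    using A by (intro similar_mat_wit_mult[of ?M n]) auto
  moreover have M: "?M \<in> carrier_mat n n" "?M * ?M \<in> carrier_mat n n"
    using A by (auto intro!: mult_carrier_mat[of _ n n] minus_carrier_mat)
  ultimately have tr: "mat_trace (?M * ?M) = 0"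
    using similar_mat_wit_trace[OF M(2)] by simp
  have c: "?S A c \<in> carrier_mat n n" for c using A by auto
  have t: "(?S A c)\<^sup>T = ?S A c" for c
    using A sym by (auto simp: transpose_minus[of _ n n] mat_eq_iff)
  \<comment> \<open>Transposition reverses the two factors; as they commute, \<open>?M\<close> is
    symmetric.\<close>
  have "?M\<^sup>T = ?S A b * ?S A a" using c by (simp add: transpose_mult[of _ n n _ n] t)
  also have "\<dots> = ?M" unfolding mat_minus_smult_one_mult[OF A] by (simp add: ac_simps)
  finally have "?M = 0\<^sub>m n n"
    using symmetric_mat_eq_0_if_trace_square_0[OF M(1)] tr by simp
  then have 0: "A * A - (a + b) \<cdot>\<^sub>m A + (a * b) \<cdot>\<^sub>m 1\<^sub>m n = 0\<^sub>m n n"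
    unfolding mat_minus_smult_one_mult[OF A] .
  show ?thesis
  proof (rule eq_matI)
    fix i j
    assume "i < dim_row ((a + b) \<cdot>\<^sub>m A - (a * b) \<cdot>\<^sub>m 1\<^sub>m n)"
      and "j < dim_col ((a + b) \<cdot>\<^sub>m A - (a * b) \<cdot>\<^sub>m 1\<^sub>m n)"
    then have ij: "i < n" "j < n" by auto
    have "(A * A - (a + b) \<cdot>\<^sub>m A + (a * b) \<cdot>\<^sub>m 1\<^sub>m n) $$ (i, j) = 0"
      unfolding 0 using ij by simp
    then show "(A * A) $$ (i, j) = ((a + b) \<cdot>\<^sub>m A - (a * b) \<cdot>\<^sub>m 1\<^sub>m n) $$ (i, j)"
      using A ij by simp
  qed (use A in auto)
qed

section \<open>Cokernels of integer matrices\<close>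

lemma mult_mat_unit_vec:
  fixes A :: "'a :: comm_ring_1 mat"
  assumes "j < dim_col A"
  shows "A *\<^sub>v unit_vec (dim_col A) j = col A j"
  using assms by (intro eq_vecI) auto

lemma mult_mat_smult_vec:
  fixes A :: "'a :: comm_ring_1 mat"
  assumes "A \<in> carrier_mat nr nc" "v \<in> carrier_vec nc"
  shows "A *\<^sub>v (k \<cdot>\<^sub>v v) = k \<cdot>\<^sub>v (A *\<^sub>v v)"
  using assms by (intro eq_vecI) auto

lemma monoid_vec_inv:
  fixes v :: "'a :: ab_group_add vec"
  assumes "v \<in> carrier_vec n"
  shows "inv\<^bsub>monoid_vec TYPE('a) n\<^esub> v = - v"
proof -
  interpret Z: comm_group "monoid_vec TYPE('a) n" by (rule comm_group_vec)
  show ?thesis using assms by (intro Z.inv_equality) (auto simp: monoid_vec_simps)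
qed

lemma monoid_vec_nat_pow:
  fixes v :: "'a :: comm_ring_1 vec"
  assumes "v \<in> carrier_vec n"
  shows "v [^]\<^bsub>monoid_vec TYPE('a) n\<^esub> (m :: nat) = of_nat m \<cdot>\<^sub>v v"
proof -
  interpret Z: comm_group "monoid_vec TYPE('a) n" by (rule comm_group_vec)
  show ?thesis using assms
    by (induction m) (auto simp: monoid_vec_simps add_smult_distrib_vec[symmetric] algebra_simps)
qed

lemma monoid_vec_int_pow:
  fixes v :: "'a :: comm_ring_1 vec"
  assumes "v \<in> carrier_vec n"
  shows "v [^]\<^bsub>monoid_vec TYPE('a) n\<^esub> (k :: int) = of_int k \<cdot>\<^sub>v v"
proof (cases "k < 0")
  case True
  have "- (of_nat (nat (- k)) \<cdot>\<^sub>v v) = of_int k \<cdot>\<^sub>v v"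
    using True by (intro eq_vecI) simp_all
  with True assms show ?thesis
    by (simp only: int_pow_def2 monoid_vec_nat_pow monoid_vec_inv smult_carrier_vec if_True)
next
  case False
  with assms show ?thesis
    by (simp only: int_pow_def2 monoid_vec_nat_pow if_False) simp
qed

text \<open>The image of \<open>A\<^sup>T\<close> is a subgroup and contains each row as the image
  of a unit vector; conversely its elements are integer combinations of rows. Membership in the row
  lattice thus becomes solvability of a linear system.\<close>

lemma generate_rows:
  fixes A :: "int mat"
  assumes A: "A \<in> carrier_mat m n"
  shows "generate (monoid_vec TYPE(int) n) (set (rows A)) = (\<lambda>y. A\<^sup>T *\<^sub>v y) ` carrier_vec m"
    (is "generate ?Z ?R = ?H")
proof
  interpret Z: comm_group ?Z by (rule comm_group_vec)
  have R: "?R \<subseteq> carrier ?Z" using A by (auto simp: rows_def monoid_vec_simps)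
  have H: "subgroup ?H ?Z"
  proof (rule Z.subgroupI)
    show "?H \<subseteq> carrier ?Z" using A by (auto simp: monoid_vec_simps)
    show "?H \<noteq> {}" using zero_carrier_vec[of m] by blast
    show "inv\<^bsub>?Z\<^esub> x \<in> ?H" if "x \<in> ?H" for x
    proof -
      obtain y where y: "y \<in> carrier_vec m" "x = A\<^sup>T *\<^sub>v y" using \<open>x \<in> ?H\<close> by blast
      have "inv\<^bsub>?Z\<^esub> x = - x" using y A by (intro monoid_vec_inv) auto
      also have "- x = A\<^sup>T *\<^sub>v (- y)" using y A by (intro eq_vecI) (auto simp: scalar_prod_uminus_right)
      finally show ?thesis using y by auto
    qed
    show "x \<otimes>\<^bsub>?Z\<^esub> x' \<in> ?H" if "x \<in> ?H" "x' \<in> ?H" for x x'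
    proof -
      obtain y y' where "y \<in> carrier_vec m" "x = A\<^sup>T *\<^sub>v y" "y' \<in> carrier_vec m" "x' = A\<^sup>T *\<^sub>v y'"
        using \<open>x \<in> ?H\<close> \<open>x' \<in> ?H\<close> by blast
      with A show ?thesis
        by (auto simp: monoid_vec_simps mult_add_distrib_mat_vec[of _ n m, symmetric])
    qed
  qed
  have "row A i \<in> ?H" if "i < m" for i
    using mult_mat_unit_vec[of i "A\<^sup>T"] that A by (auto intro!: image_eqI[of _ _ "unit_vec m i"])
  then have "?R \<subseteq> ?H" using A by (auto simp: rows_def)
  then show "generate ?Z ?R \<subseteq> ?H" using H by (rule Z.generate_subgroup_incl)
  have gen: "subgroup (generate ?Z ?R) ?Z" using R by (rule Z.generate_is_subgroup)
  show "?H \<subseteq> generate ?Z ?R"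
  proof
    fix x assume "x \<in> ?H"
    then obtain y where y: "y \<in> carrier_vec m" "x = A\<^sup>T *\<^sub>v y" by blast
    \<comment> \<open>Truncating \<open>y\<close> after \<open>k\<close> coordinates lets the
      induction add one multiple of a row at a time.\<close>
    define t where "t k = vec m (\<lambda>i. if i < k then y $ i else 0)" for k
    have "k \<le> m \<Longrightarrow> A\<^sup>T *\<^sub>v t k \<in> generate ?Z ?R" for k
    proof (induction k)
      case 0
      have "A\<^sup>T *\<^sub>v t 0 = \<one>\<^bsub>?Z\<^esub>"
        using A by (intro eq_vecI) (auto simp: t_def monoid_vec_simps scalar_prod_def)
      then show ?case using subgroup.one_closed[OF gen] by simp
    next
      case (Suc k)
      have t_Suc: "t (Suc k) = t k + y $ k \<cdot>\<^sub>v unit_vec m k"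
        using Suc.prems by (intro eq_vecI) (auto simp: t_def less_Suc_eq)
      have "A\<^sup>T *\<^sub>v t (Suc k) = A\<^sup>T *\<^sub>v t k + y $ k \<cdot>\<^sub>v (A\<^sup>T *\<^sub>v unit_vec m k)"
        unfolding t_Suc using A
        by (simp add: mult_add_distrib_mat_vec[of _ n m] mult_mat_smult_vec[of _ n m] t_def)
      also have "A\<^sup>T *\<^sub>v unit_vec m k = row A k"
        using mult_mat_unit_vec[of k "A\<^sup>T"] A Suc.prems by simp
      also have "y $ k \<cdot>\<^sub>v row A k = row A k [^]\<^bsub>?Z\<^esub> (y $ k)"
        using A by (subst monoid_vec_int_pow) auto
      finally have step: "A\<^sup>T *\<^sub>v t (Suc k) = A\<^sup>T *\<^sub>v t k \<otimes>\<^bsub>?Z\<^esub> row A k [^]\<^bsub>?Z\<^esub> (y $ k)"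
        by (simp add: monoid_vec_simps)
      have "row A k \<in> generate ?Z ?R"
        using A Suc.prems by (intro generate.incl) (auto simp: rows_def)
      then have "row A k [^]\<^bsub>?Z\<^esub> (y $ k) \<in> generate ?Z ?R"
        by (rule Z.subgroup_int_pow_closed[OF gen])
      with Suc show ?case unfolding step by (intro subgroup.m_closed[OF gen]) auto
    qed
    moreover have "t m = y" using y by (intro eq_vecI) (auto simp: t_def)
    ultimately show "x \<in> generate ?Z ?R" using y by (metis order_refl)
  qed
qed

section \<open>Exponents of cokernels\<close>

text \<open>The case \<open>e = 0\<close> is included: then only \<open>m = 0\<close> annihilates,
  and the default value \<open>0\<close> of \<open>group_exponent\<close> results.\<close>

lemma group_exponentI:
  assumes "\<And>m :: nat. (\<forall>x\<in>carrier G. x [^]\<^bsub>G\<^esub> m = \<one>\<^bsub>G\<^esub>) \<longleftrightarrow> e dvd m"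
  shows "group_exponent G = e"
proof (cases "e = 0")
  case True
  then show ?thesis by (simp add: group_exponent_def assms)
next
  case False
  then have "(LEAST m. 0 < m \<and> e dvd m) = e" by (intro Least_equality) (auto dest: dvd_imp_le)
  with False show ?thesis by (auto simp: group_exponent_def assms)
qed

text \<open>The \<open>m\<close>-th power of the coset of \<open>v\<close> is the coset of
  \<open>m v\<close>, which is trivial exactly when \<open>m v\<close> lies in the row
  lattice.\<close>

lemma int_cokernel_annihilated_iff:
  fixes A :: "int mat"
  assumes A: "A \<in> carrier_mat r n"
  shows "(\<forall>x\<in>carrier (int_cokernel A). x [^]\<^bsub>int_cokernel A\<^esub> (m :: nat) = \<one>\<^bsub>int_cokernel A\<^esub>)
    \<longleftrightarrow> (\<forall>v\<in>carrier_vec n. \<exists>y\<in>carrier_vec r. int m \<cdot>\<^sub>v v = A\<^sup>T *\<^sub>v y)"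
proof -
  let ?Z = "monoid_vec TYPE(int) n" and ?H = "generate (monoid_vec TYPE(int) n) (set (rows A))"
  interpret Z: comm_group ?Z by (rule comm_group_vec)
  have "set (rows A) \<subseteq> carrier ?Z" using A by (auto simp: rows_def monoid_vec_simps)
  then have H: "subgroup ?H ?Z" by (rule Z.generate_is_subgroup)
  then interpret H: normal ?H ?Z by (rule Z.subgroup_imp_normal)
  have K: "int_cokernel A = ?Z Mod ?H" using A by (simp add: int_cokernel_def)
  have "(?H #>\<^bsub>?Z\<^esub> v) [^]\<^bsub>int_cokernel A\<^esub> m = \<one>\<^bsub>int_cokernel A\<^esub>
      \<longleftrightarrow> (\<exists>y\<in>carrier_vec r. int m \<cdot>\<^sub>v v = A\<^sup>T *\<^sub>v y)" if v: "v \<in> carrier_vec n" for v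
  proof -
    have "(?H #>\<^bsub>?Z\<^esub> v) [^]\<^bsub>?Z Mod ?H\<^esub> m = ?H #>\<^bsub>?Z\<^esub> (int m \<cdot>\<^sub>v v)"
      using v H.FactGroup_pow[of v m] by (simp add: monoid_vec_simps monoid_vec_nat_pow)
    moreover have "?H #>\<^bsub>?Z\<^esub> (int m \<cdot>\<^sub>v v) = ?H \<longleftrightarrow> int m \<cdot>\<^sub>v v \<in> ?H"
      using v Z.coset_join1[OF _ _ H] Z.coset_join2[OF _ H] H.subset
      by (auto simp: monoid_vec_simps)
    ultimately show ?thesis unfolding K generate_rows[OF A] by auto
  qed
  then show ?thesis unfolding K by (auto simp: carrier_FactGroup monoid_vec_simps)
qed

text \<open>The quadratic relation makes \<open>p\<close> an annihilator; the off-diagonal entry of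
  absolute value 1 makes every annihilator a multiple of \<open>p\<close>.\<close>

lemma group_exponent_int_cokernel_quadratic:
  fixes L :: "int mat"
  assumes L: "L \<in> carrier_mat n n" and sym: "L\<^sup>T = L"
    and quad: "L * L = s \<cdot>\<^sub>m L - int p \<cdot>\<^sub>m 1\<^sub>m n"
    and ij: "i < n" "j < n" "i \<noteq> j" and unit: "\<bar>L $$ (i, j)\<bar> = 1"
  shows "group_exponent (int_cokernel L) = p"
\<comment> \<open>By symmetry of \<open>L\<close>, the transpose disappears and the system to solve
  is \<open>L y = m v\<close>.\<close>
proof (rule group_exponentI, unfold int_cokernel_annihilated_iff[OF L] sym)
  let ?K = "s \<cdot>\<^sub>m 1\<^sub>m n - L"
  have K: "?K \<in> carrier_mat n n" using L by auto
  have "L * ?K = s \<cdot>\<^sub>m L - L * L"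
    using L by (subst mult_minus_distrib_mat[of _ n n]) (auto simp: mult_smult_distrib[of _ n n _ n])
  also have "\<dots> = int p \<cdot>\<^sub>m 1\<^sub>m n" unfolding quad using L by (auto simp: mat_eq_iff)
  finally have LK: "L * ?K = int p \<cdot>\<^sub>m 1\<^sub>m n" .
  have "?K * L = s \<cdot>\<^sub>m L - L * L"
    using L by (subst minus_mult_distrib_mat[of _ n n]) (auto simp: mult_smult_assoc_mat[of _ n n _ n])
  also have "\<dots> = int p \<cdot>\<^sub>m 1\<^sub>m n" unfolding quad using L by (auto simp: mat_eq_iff)
  finally have KL: "?K * L = int p \<cdot>\<^sub>m 1\<^sub>m n" .
  have scalar: "(c \<cdot>\<^sub>m 1\<^sub>m n) *\<^sub>v v = c \<cdot>\<^sub>v v" if "v \<in> carrier_vec n" for c :: int and v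
    using that by (intro eq_vecI) (auto simp: row_smult row_one)
  fix m :: nat
  show "(\<forall>v\<in>carrier_vec n. \<exists>y\<in>carrier_vec n. int m \<cdot>\<^sub>v v = L *\<^sub>v y) \<longleftrightarrow> p dvd m"
  proof
    assume "\<forall>v\<in>carrier_vec n. \<exists>y\<in>carrier_vec n. int m \<cdot>\<^sub>v v = L *\<^sub>v y"
    then obtain y where y: "y \<in> carrier_vec n" "int m \<cdot>\<^sub>v unit_vec n j = L *\<^sub>v y"
      using unit_vec_carrier by blast
    have "int p \<cdot>\<^sub>v y = ?K *\<^sub>v (L *\<^sub>v y)"
      using y L K KL scalar by (simp flip: assoc_mult_mat_vec[of _ n n _ n])
    also have "\<dots> = int m \<cdot>\<^sub>v col ?K j"
      using K L ij mult_mat_unit_vec[of j ?K] by (simp add: mult_mat_smult_vec[of _ n n] flip: y(2))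
    finally have "(int p \<cdot>\<^sub>v y) $ i = (int m \<cdot>\<^sub>v col ?K j) $ i" by simp
    \<comment> \<open>Since \<open>i \<noteq> j\<close>, the scalar part of \<open>?K\<close>
      contributes nothing to this entry.\<close>
    then have "int m * - L $$ (i, j) = int p * y $ i" using ij L y by simp
    then have "int p dvd int m * L $$ (i, j)" by (metis dvd_minus_iff dvd_triv_left mult_minus_right)
    moreover have "L $$ (i, j) = 1 \<or> L $$ (i, j) = - 1" using unit by linarith
    ultimately show "p dvd m" by auto
  next
    assume "p dvd m"
    then obtain k where k: "m = p * k" by blast
    show "\<forall>v\<in>carrier_vec n. \<exists>y\<in>carrier_vec n. int m \<cdot>\<^sub>v v = L *\<^sub>v y"
    proof
      fix v :: "int vec" assume v: "v \<in> carrier_vec n"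
      \<comment> \<open>As \<open>m = p * k\<close>, the preimage of \<open>m v\<close> under
        \<open>L\<close> is \<open>?K\<close> applied to \<open>k v\<close>.\<close>
      then have "L *\<^sub>v (?K *\<^sub>v (int k \<cdot>\<^sub>v v)) = int p \<cdot>\<^sub>v (int k \<cdot>\<^sub>v v)"
        using L K LK scalar by (simp flip: assoc_mult_mat_vec[of _ n n _ n])
      then have "int m \<cdot>\<^sub>v v = L *\<^sub>v (?K *\<^sub>v (int k \<cdot>\<^sub>v v))"
        by (simp add: k smult_smult_assoc)
      then show "\<exists>y\<in>carrier_vec n. int m \<cdot>\<^sub>v v = L *\<^sub>v y" using K v by auto
    qed
  qed
qed

section \<open>Signed Laplacians\<close>

text \<open>Gershgorin's argument: the row at a coordinate where the eigenvector is largest in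
  absolute value gives \<open>\<bar>x - A $$ (i, i)\<bar> \<le> A $$ (i, i)\<close>.\<close>

lemma diagonally_dominant_eigenvalue_nonneg:
  fixes A :: "real mat"
  assumes A: "A \<in> carrier_mat n n"
    and dom: "\<And>i. i < n \<Longrightarrow> (\<Sum>j\<in>{..<n} - {i}. \<bar>A $$ (i, j)\<bar>) \<le> A $$ (i, i)"
    and ev: "eigenvalue A x"
  shows "0 \<le> x"
proof -
  obtain v where v: "v \<in> carrier_vec n" "v \<noteq> 0\<^sub>v n" "A *\<^sub>v v = x \<cdot>\<^sub>v v"
    using ev A unfolding eigenvalue_def eigenvector_def by auto
  obtain l where l: "l < n" "v $ l \<noteq> 0" using v(1,2) by force
  then obtain i where i: "i < n" and max: "\<And>j. j < n \<Longrightarrow> \<bar>v $ j\<bar> \<le> \<bar>v $ i\<bar>"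
    using obtains_MAX[of "{..<n}" "\<lambda>j. \<bar>v $ j\<bar>"] by (metis finite_lessThan Max_ge empty_iff finite_imageI imageI lessThan_iff)
  have vi: "0 < \<bar>v $ i\<bar>" using max[OF l(1)] l(2) by linarith
  have "x * v $ i = (A *\<^sub>v v) $ i" using v i by simp
  also have "\<dots> = (\<Sum>j<n. A $$ (i, j) * v $ j)"
    using A v(1) i by (simp add: scalar_prod_def atLeast0LessThan)
  also have "\<dots> = A $$ (i, i) * v $ i + (\<Sum>j\<in>{..<n} - {i}. A $$ (i, j) * v $ j)"
    using i by (simp add: sum.remove)
  finally have "\<bar>(x - A $$ (i, i)) * v $ i\<bar> = \<bar>\<Sum>j\<in>{..<n} - {i}. A $$ (i, j) * v $ j\<bar>"
    by (simp add: algebra_simps)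
  also have "\<dots> \<le> (\<Sum>j\<in>{..<n} - {i}. \<bar>A $$ (i, j)\<bar> * \<bar>v $ i\<bar>)"
    by (rule order_trans[OF sum_abs]) (auto intro!: sum_mono mult_left_mono max simp: abs_mult)
  also have "\<dots> \<le> A $$ (i, i) * \<bar>v $ i\<bar>"
    using dom[OF i] by (auto intro!: mult_right_mono simp flip: sum_distrib_right)
  finally have "\<bar>x - A $$ (i, i)\<bar> \<le> A $$ (i, i)" using vi by (simp add: abs_mult)
  then show ?thesis by linarith
qed

section \<open>Entries of the signed Laplacian\<close>

lemma signed_laplacian_carrier: "signed_laplacian G \<sigma> vs \<in> carrier_mat (length vs) (length vs)"
  by (simp add: signed_laplacian_def degree_matrix_def signed_adjacency_matrix_def minus_carrier_mat)

lemma signed_laplacian_off_diagonal: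
  assumes "i < length vs" "j < length vs" "i \<noteq> j"
  shows "signed_laplacian G \<sigma> vs $$ (i, j) =
    (if (vs ! i, vs ! j) \<in> parcs G then (case \<sigma> {vs ! i, vs ! j} of Pos \<Rightarrow> - 1 | Neg \<Rightarrow> 1) else 0)"
  using assms
  by (auto simp: signed_laplacian_def degree_matrix_def signed_adjacency_matrix_def mat_diag_def split: sign.split)

lemma abs_signed_laplacian_off_diagonal:
  assumes "i < length vs" "j < length vs" "i \<noteq> j"
  shows "\<bar>signed_laplacian G \<sigma> vs $$ (i, j)\<bar> = of_bool ((vs ! i, vs ! j) \<in> parcs G)"
  using assms by (auto simp: signed_laplacian_off_diagonal split: sign.split)

context pair_graph
begin

lemma signed_laplacian_symmetric: "(signed_laplacian G \<sigma> vs)\<^sup>T = signed_laplacian G \<sigma> vs"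
proof -
  have "sym (parcs G)" using pair_sym_arcs by (simp add: symmetric_def)
  then have "(u, v) \<in> parcs G \<longleftrightarrow> (v, u) \<in> parcs G" for u v by (auto dest: symD)
  then have "signed_laplacian G \<sigma> vs $$ (j, i) = signed_laplacian G \<sigma> vs $$ (i, j)"
    if "i < length vs" "j < length vs" for i j
    using that by (cases "i = j") (simp_all add: signed_laplacian_off_diagonal insert_commute)
  then show ?thesis using signed_laplacian_carrier[of G \<sigma> vs] by (intro eq_matI) auto
qed

text \<open>The arcs leaving a vertex correspond to the indices of its neighbours, and each of these
  contributes absolute value 1. Diagonal dominance thus holds with equality.\<close>

lemma signed_laplacian_diagonal:
  assumes "distinct vs" "set vs = pverts G" "i < length vs"
  shows "signed_laplacian G \<sigma> vs $$ (i, i) = (\<Sum>j\<in>{..<length vs} - {i}. \<bar>signed_laplacian G \<sigma> vs $$ (i, j)\<bar>)"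
proof -
  let ?n = "length vs"
  \<comment> \<open>Without loops the adjacency matrix vanishes on the diagonal, and the neighbours
    of \<open>vs ! i\<close> have indices other than \<open>i\<close>.\<close>
  have loop: "(vs ! i, vs ! i) \<notin> parcs G" using pair_no_loops by force
  have "bij_betw (\<lambda>j. (vs ! i, vs ! j)) {j. j < ?n \<and> (vs ! i, vs ! j) \<in> parcs G}
    (out_arcs (with_proj G) (vs ! i))"
    unfolding bij_betw_def
  proof
    show "inj_on (\<lambda>j. (vs ! i, vs ! j)) {j. j < ?n \<and> (vs ! i, vs ! j) \<in> parcs G}"
      using assms(1) by (auto intro!: inj_onI simp: nth_eq_iff_index_eq)
    show "(\<lambda>j. (vs ! i, vs ! j)) ` {j. j < ?n \<and> (vs ! i, vs ! j) \<in> parcs G} = out_arcs (with_proj G) (vs ! i)"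
      using assms(2) by (auto simp: out_arcs_def image_iff) (metis in_arcsD2 in_set_conv_nth)
  qed
  from bij_betw_same_card[OF this]
  have "out_degree (with_proj G) (vs ! i) = card {j. j < ?n \<and> (vs ! i, vs ! j) \<in> parcs G}"
    by (simp only: out_degree_def)
  moreover have "{j. j < ?n \<and> (vs ! i, vs ! j) \<in> parcs G} = {j \<in> {..<?n} - {i}. (vs ! i, vs ! j) \<in> parcs G}"
    using loop by auto
  moreover have "signed_laplacian G \<sigma> vs $$ (i, i) = int (out_degree (with_proj G) (vs ! i))"
    using assms(3) loop by (simp add: signed_laplacian_def degree_matrix_def signed_adjacency_matrix_def mat_diag_def)
  moreover have "(\<Sum>j\<in>{..<?n} - {i}. \<bar>signed_laplacian G \<sigma> vs $$ (i, j)\<bar>)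
      = (\<Sum>j\<in>{..<?n} - {i}. of_bool ((vs ! i, vs ! j) \<in> parcs G))"
    using assms(3) by (intro sum.cong) (auto simp: abs_signed_laplacian_off_diagonal)
  ultimately show ?thesis by (simp add: sum_of_bool_eq Int_def conj_commute)
qed

text \<open>A cycle violating balance is a nonempty list of arcs. The arc later provides the unit
  entry of the Laplacian.\<close>

lemma unbalanced_imp_arc:
  assumes "\<not> balanced G \<sigma>"
  obtains u v where "(u, v) \<in> parcs G"
proof -
  obtain p where p: "cycle p" "3 \<le> length p" using assms unfolding balanced_def by blast
  then have "set p \<subseteq> parcs G" "p \<noteq> []" by (auto simp: cycle_def awalk_def)
  then show ?thesis using that by (cases p) auto
qed

end

section \<open>Integrality of the eigenvalue sum and product, and the exponent\<close>

theorem theorem1p3: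
  fixes G :: "'v pair_pre_digraph" and \<sigma> :: "'v set \<Rightarrow> sign" and vs :: "'v list"
    and \<theta>\<^sub>1 \<theta>\<^sub>2 :: real
  assumes "pair_graph G"
    and "Digraph_Component.connected (with_proj G)"
    and "\<not> balanced G \<sigma>"
    and "distinct vs" and "set vs = pverts G"
    and "spectrum (map_mat real_of_int (signed_laplacian G \<sigma> vs)) = {\<theta>\<^sub>1, \<theta>\<^sub>2}"
    and "\<theta>\<^sub>1 \<noteq> \<theta>\<^sub>2"
  shows "real (group_exponent (critical_group G \<sigma> vs)) = \<theta>\<^sub>1 * \<theta>\<^sub>2"
proof -
  interpret pair_graph G by fact
  define n where "n = length vs"
  define L where "L = signed_laplacian G \<sigma> vs"
  let ?R = "map_mat real_of_int L"
  have L: "L \<in> carrier_mat n n" unfolding L_def n_def by (rule signed_laplacian_carrier)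
  have sym: "L\<^sup>T = L" unfolding L_def by (rule signed_laplacian_symmetric)
  have R: "?R \<in> carrier_mat n n" using L by simp
  have spec: "spectrum ?R = {\<theta>\<^sub>1, \<theta>\<^sub>2}" using assms(6) by (simp add: L_def)
  have "?R\<^sup>T = ?R" by (simp add: map_mat_transpose sym)
  then have "?R * ?R = (\<theta>\<^sub>1 + \<theta>\<^sub>2) \<cdot>\<^sub>m ?R - (\<theta>\<^sub>1 * \<theta>\<^sub>2) \<cdot>\<^sub>m 1\<^sub>m n"
    using R spec by (intro symmetric_real_mat_two_eigenvalues) auto
  then have quad: "map_mat real_of_int (L * L) = (\<theta>\<^sub>1 + \<theta>\<^sub>2) \<cdot>\<^sub>m ?R - (\<theta>\<^sub>1 * \<theta>\<^sub>2) \<cdot>\<^sub>m 1\<^sub>m n"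
    by (simp add: of_int_hom.mat_hom_mult[OF L L])
  have entry: "real_of_int ((L * L) $$ (k, l)) =
      (\<theta>\<^sub>1 + \<theta>\<^sub>2) * real_of_int (L $$ (k, l)) - (\<theta>\<^sub>1 * \<theta>\<^sub>2) * of_bool (k = l)"
    if "k < n" "l < n" for k l
  proof -
    have "real_of_int ((L * L) $$ (k, l)) = map_mat real_of_int (L * L) $$ (k, l)"
      using that L by simp
    then show ?thesis unfolding quad using that L by simp
  qed

  obtain u v where arc: "(u, v) \<in> parcs G" using unbalanced_imp_arc[OF assms(3)] .
  then obtain i j where ij: "i < n" "j < n" "u = vs ! i" "v = vs ! j"
    using in_arcsD1 in_arcsD2 assms(5) by (metis in_set_conv_nth n_def)
  with arc have "i \<noteq> j" using pair_no_loops[OF arc] by auto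
  then have unit: "\<bar>L $$ (i, j)\<bar> = 1"
    using ij arc abs_signed_laplacian_off_diagonal[of i vs j G \<sigma>] by (simp add: L_def n_def)

  \<comment> \<open>The entry equation at \<open>(i, j)\<close> is solved for the eigenvalue sum:
    since \<open>L $$ (i, j)\<close> is its own inverse, division becomes multiplication.\<close>
  define s where "s = (L * L) $$ (i, j) * L $$ (i, j)"
  have "L $$ (i, j) = 1 \<or> L $$ (i, j) = - 1" using unit by linarith
  then have s: "\<theta>\<^sub>1 + \<theta>\<^sub>2 = real_of_int s"
    using entry[OF ij(1,2)] \<open>i \<noteq> j\<close> unfolding s_def by auto
  \<comment> \<open>With the sum known to be an integer, the diagonal entry equation gives the
    product.\<close>
  define q where "q = s * L $$ (i, i) - (L * L) $$ (i, i)"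
  have q: "\<theta>\<^sub>1 * \<theta>\<^sub>2 = real_of_int q"
    using entry[OF ij(1) ij(1)] unfolding q_def s by simp

  have dom: "(\<Sum>l\<in>{..<n} - {k}. \<bar>?R $$ (k, l)\<bar>) \<le> ?R $$ (k, k)" if "k < n" for k
  proof -
    have "(\<Sum>l\<in>{..<n} - {k}. \<bar>?R $$ (k, l)\<bar>) = real_of_int (\<Sum>l\<in>{..<n} - {k}. \<bar>L $$ (k, l)\<bar>)"
      unfolding of_int_sum using L that by (intro sum.cong) auto
    also have "\<dots> = ?R $$ (k, k)"
      using signed_laplacian_diagonal[OF assms(4,5), of k \<sigma>] L that by (simp add: L_def n_def)
    finally show ?thesis by simp
  qed
  have "0 \<le> \<theta>" if "\<theta> \<in> {\<theta>\<^sub>1, \<theta>\<^sub>2}" for \<theta>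
    using diagonally_dominant_eigenvalue_nonneg[OF R dom] that unfolding spec[symmetric]
    by (simp add: spectrum_def)
  then have "0 \<le> \<theta>\<^sub>1 * \<theta>\<^sub>2" by simp
  \<comment> \<open>Nonnegativity ensures that \<open>nat\<close> does not truncate, as the exponent
    is a natural number.\<close>
  then have nat_q: "int (nat q) = q" using q by simp

  have "L * L = s \<cdot>\<^sub>m L - int (nat q) \<cdot>\<^sub>m 1\<^sub>m n"
  proof (rule eq_matI)
    fix k l
    assume "k < dim_row (s \<cdot>\<^sub>m L - int (nat q) \<cdot>\<^sub>m 1\<^sub>m n)"
      and "l < dim_col (s \<cdot>\<^sub>m L - int (nat q) \<cdot>\<^sub>m 1\<^sub>m n)"
    then have kl: "k < n" "l < n" by auto
    \<comment> \<open>All coefficients are now integers, so the real equation descends to the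
      integers by injectivity of \<open>real_of_int\<close>.\<close>
    have "real_of_int ((L * L) $$ (k, l)) = real_of_int (s * L $$ (k, l) - q * of_bool (k = l))"
      unfolding entry[OF kl] s q by simp
    then show "(L * L) $$ (k, l) = (s \<cdot>\<^sub>m L - int (nat q) \<cdot>\<^sub>m 1\<^sub>m n) $$ (k, l)"
      using L kl unfolding of_int_eq_iff nat_q by simp
  qed (use L in auto)
  then have "group_exponent (int_cokernel L) = nat q"
    using group_exponent_int_cokernel_quadratic[OF L sym _ ij(1,2) \<open>i \<noteq> j\<close> unit] by blast
  then show ?thesis unfolding critical_group_def L_def[symmetric] q
    using nat_q by (metis of_int_of_nat_eq)
qed

end
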